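(* As formal power series in $t$, $$1+\sum_{\pi\neq\emptyset} x^{1+(12)\pi}y^{(21)\pi}p^{(2\text{-}31)\pi}q^{(31\text{-}2)\pi}t^{|\pi|}=\cfrac{1}{1-\cfrac{x[1]_{p,q}t}{1-\cfrac{y[1]_{p,q}t}{1-\cfrac{x[2]_{p,q}t}{1-\cfrac{y[2]_{p,q}t}{\ddots}}}}},$$ where the sum is over all nonempty permutations $\pi$ of $[n]$, $n\ge1$, the continued fraction has successive partial numerators $x[1]_{p,q}t,\,y[1]_{p,q}t,\,x[2]_{p,q}t,\,y[2]_{p,q}t,\,x[3]_{p,q}t,\dots$, and $[n]_{p,q}=q^{n-1}+pq^{n-2}+\cdots+p^{n-2}q+p^{n-1}$.
   Context: For a permutation $\pi=a_1\cdots a_n$: $|\pi|=n$; $(12)\pi$ is the number of $i$ with $a_i<a_{i+1}$ (ascents); $(21)\pi$ is the number of $i$ with $a_i>a_{i+1}$ (descents); $(2\text{-}31)\pi$ is the number of pairs $(i,j)$ with $1\le i<j<n$ and $a_{j+1}<a_i<a_j$; $(31\text{-}2)\pi$ is the number of pairs $(i,j)$ with $i+1<j\le n$ and $a_{i+1}<a_j<a_i$. *)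

theory Defs
  imports
    "HOL-Computational_Algebra.Formal_Power_Series"
    "HOL-Combinatorics.Multiset_Permutations"
begin

text \<open>
  A permutation \<open>a\<^sub>1 \<dots> a\<^sub>n\<close> of \<open>[n]\<close> is represented by its one-line notation, a list in
  \<^term>\<open>permutations_of_set {1..n::nat}\<close>. List positions start at \<open>0\<close>, so
  \<open>a\<^sub>i\<close> is the list entry at position \<open>i - 1\<close>.
\<close>

definition pat_12 :: "nat list \<Rightarrow> nat" where
  "pat_12 a = card {i. Suc i < length a \<and> a ! i < a ! Suc i}"

definition pat_21 :: "nat list \<Rightarrow> nat" where
  "pat_21 a = card {i. Suc i < length a \<and> a ! i > a ! Suc i}"

definition pat_2_31 :: "nat list \<Rightarrow> nat" where
  "pat_2_31 a =
     card {(i, j). i < j \<and> Suc j < length a \<and> a ! Suc j < a ! i \<and> a ! i < a ! j}"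

definition pat_31_2 :: "nat list \<Rightarrow> nat" where
  "pat_31_2 a =
     card {(i, j). Suc i < j \<and> j < length a \<and> a ! Suc i < a ! j \<and> a ! j < a ! i}"

definition pq_bracket :: "'a::comm_ring_1 \<Rightarrow> 'a \<Rightarrow> nat \<Rightarrow> 'a" where
  "pq_bracket p q n = (\<Sum>k<n. p ^ k * q ^ (n - 1 - k))"

text \<open>
  \<open>cfrac_tail c k N\<close> is the finite continued fraction
  \<open>1 / (1 - c\<^sub>k / (1 - c\<^sub>k\<^sub>+\<^sub>1 / (\<dots> / (1 - c\<^sub>k\<^sub>+\<^sub>N\<^sub>-\<^sub>1))))\<close>. The coefficients only form a
  commutative ring, so the reciprocal is taken with \<^term>\<open>fps_right_inverse\<close>, whose second
  argument is the inverse of the constant coefficient. This is a reciprocal whenever every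
  \<open>c\<^sub>i\<close> has constant coefficient \<open>0\<close>, as then every denominator has constant coefficient \<open>1\<close>.
\<close>

fun cfrac_tail :: "(nat \<Rightarrow> 'a::comm_ring_1 fps) \<Rightarrow> nat \<Rightarrow> nat \<Rightarrow> 'a fps" where
  "cfrac_tail c k 0 = 1"
| "cfrac_tail c k (Suc N) = fps_right_inverse (1 - c k * cfrac_tail c (Suc k) N) 1"

text \<open>
  An infinite continued fraction denotes the limit of its convergents in the metric of formal
  power series, i.e. every coefficient is eventually constant along the convergents.
\<close>

definition has_cfrac :: "'a::comm_ring_1 fps \<Rightarrow> (nat \<Rightarrow> 'a fps) \<Rightarrow> bool" where
  "has_cfrac F c \<longleftrightarrow> (\<lambda>N. cfrac_tail c 0 N) \<longlonglongrightarrow> F"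

lemma cfrac_tail_reciprocal:
  assumes "\<And>i. fps_nth (c i) 0 = 0"
  shows "cfrac_tail c k (Suc N) * (1 - c k * cfrac_tail c (Suc k) N) = 1"
proof -
  let ?d = "1 - c k * cfrac_tail c (Suc k) N"
  have "?d * fps_right_inverse ?d 1 = 1"
    using assms by (intro fps_right_inverse) simp
  then show ?thesis by (simp add: mult.commute)
qed

end

theory Submission
  imports Defs
begin

text \<open>
  By Flajolet's theory of continued fractions, the right-hand side enumerates Dyck paths in which
  the steps between levels \<open>k\<close> and \<open>k + 1\<close> have weights whose product is the \<open>k\<close>-th coefficient.

  A word \<open>\<pi> \<infinity>\<close>, where \<open>\<pi>\<close> is a permutation of \<open>[n]\<close>, is built by inserting \<open>1, \<dots>, n\<close> in this order
  (the bijection of Francon and Viennot). After stage \<open>v\<close> every maximal run of letters above \<open>v\<close> is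
  recorded by a single \<open>\<infinity>\<close>, so that the state is a word with \<open>h + 1\<close> isolated letters \<open>\<infinity>\<close>, one of
  them at the end. The letter \<open>u = v + 1\<close> then replaces an \<open>\<infinity>\<close> by \<open>\<infinity>\<^sup>l u \<infinity>\<^sup>r\<close> with \<open>l, r \<in> {0, 1}\<close>,
  which creates \<open>l\<close> descents and \<open>r\<close> ascents. Each \<open>\<infinity>\<close> to the left of the replaced one begins a
  descent across \<open>u\<close>, which is a pattern 31-2; each \<open>\<infinity>\<close> to the right of \<open>u\<close> except the last begins
  the descent of a pattern 2-31. The choice among the letters \<open>\<infinity>\<close> therefore contributes
  \<open>[h + r]\<^sub>p\<^sub>,\<^sub>q\<close>.
\<close>

section \<open>Continued fractions and Dyck paths\<close>

text \<open>Euler's method: \<open>G (k + 1) / (a k * G k)\<close> is the \<open>k\<close>-th tail where the quotient makes sense.\<close>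

lemma cfrac_tail_three_term_approx:
  fixes G a b :: "nat \<Rightarrow> 'a::comm_ring_1 fps"
  assumes b_0: "\<And>k. fps_nth (b k) 0 = 0"
    and rec: "\<And>k. G (Suc k) = a k * G k + b k * G (Suc (Suc k))"
  defines "c \<equiv> \<lambda>k. a (Suc k) * b k"
  shows "fps_X ^ Suc N dvd G (Suc k) - a k * G k * cfrac_tail c k N"
proof -
  have X_dvd_b: "fps_X dvd b k" for k
  proof
    show "b k = fps_X * fps_shift 1 (b k)"
      by (rule fps_ext) (simp add: b_0)
  qed
  show ?thesis
  proof (induction N arbitrary: k)
    case 0
    have "G (Suc k) - a k * G k = b k * G (Suc (Suc k))"
      by (subst rec) simp
    then show ?case using X_dvd_b by simp
  next
    case (Suc N)
    define S T where "S = cfrac_tail c k (Suc N)" and "T = cfrac_tail c (Suc k) N"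
    have reciprocal: "S * (1 - c k * T) = 1"
      unfolding S_def T_def by (rule cfrac_tail_reciprocal) (simp add: c_def b_0)
    have "G (Suc k) - a k * G k * S = G (Suc k) * (S * (1 - c k * T)) - a k * G k * S"
      by (simp add: reciprocal)
    also have "\<dots> = S * (G (Suc k) - a k * G k - c k * T * G (Suc k))"
      by (simp add: algebra_simps)
    also have "G (Suc k) - a k * G k = b k * G (Suc (Suc k))"
      by (subst rec) simp
    also have "S * (b k * G (Suc (Suc k)) - c k * T * G (Suc k))
        = S * (b k * (G (Suc (Suc k)) - a (Suc k) * G (Suc k) * T))"
      by (simp add: c_def algebra_simps)
    finally show ?case
      using Suc.IH[of "Suc k"] X_dvd_b[of k]
      unfolding S_def T_def power_Suc[of _ "Suc N"] by (simp only: mult_dvd_mono dvd_mult)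
  qed
qed

lemma has_cfrac_three_term:
  fixes G a b :: "nat \<Rightarrow> 'a::comm_ring_1 fps"
  assumes b_0: "\<And>k. fps_nth (b k) 0 = 0"
    and rec: "\<And>k. G (Suc k) = a k * G k + b k * G (Suc (Suc k))"
    and init: "a 0 * G 0 = 1"
  shows "has_cfrac (G 1) (\<lambda>k. a (Suc k) * b k)"
  unfolding has_cfrac_def
proof (rule tendsto_fpsI)
  fix n
  let ?c = "\<lambda>k. a (Suc k) * b k"
  have "fps_nth (cfrac_tail ?c 0 N) n = fps_nth (G 1) n" if "n \<le> N" for N
  proof -
    have "fps_X ^ Suc N dvd G 1 - cfrac_tail ?c 0 N"
      using cfrac_tail_three_term_approx[of b G a N 0, OF b_0 rec] init by simp
    then obtain R where "G 1 - cfrac_tail ?c 0 N = fps_X ^ Suc N * R" ..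
    then have "fps_nth (G 1 - cfrac_tail ?c 0 N) n = 0"
      using that by (simp add: fps_X_power_mult_nth del: power_Suc)
    then show ?thesis by simp
  qed
  then show "\<forall>\<^sub>F N in sequentially. fps_nth (cfrac_tail ?c 0 N) n = fps_nth (G 1) n"
    by (auto simp: eventually_sequentially)
qed

text \<open>The total weight of the paths of \<open>m\<close> steps from level \<open>0\<close> to level \<open>k\<close>, where the steps
  \<open>k \<rightarrow> k + 1\<close> and \<open>k + 1 \<rightarrow> k\<close> have the weights \<open>u k\<close> and \<open>d k\<close>.\<close>

fun dyck_weight :: "(nat \<Rightarrow> 'a::comm_ring_1) \<Rightarrow> (nat \<Rightarrow> 'a) \<Rightarrow> nat \<Rightarrow> nat \<Rightarrow> 'a" where
  "dyck_weight u d 0 k = of_bool (k = 0)"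
| "dyck_weight u d (Suc m) 0 = d 0 * dyck_weight u d m 1"
| "dyck_weight u d (Suc m) (Suc k) =
     u k * dyck_weight u d m k + d (Suc k) * dyck_weight u d m (Suc (Suc k))"

lemma dyck_weight_eq_0: "m < k \<Longrightarrow> dyck_weight u d m k = 0"
  by (induction u d m k rule: dyck_weight.induct) auto

lemma has_cfrac_dyck_weight:
  "has_cfrac (Abs_fps (\<lambda>n. dyck_weight u d (2 * n) 0)) (\<lambda>k. fps_const (u k * d k) * fps_X)"
proof -
  define H where "H k = Abs_fps (\<lambda>n. dyck_weight u d (2 * n + k) k)" for k
  define G where "G = case_nat 1 H"
  define a where "a = case_nat 1 (\<lambda>k. fps_const (u k))"
  define b where "b k = fps_const (d k) * fps_X" for k
  have b_mult_nth: "fps_nth (b k * F) n = (if n = 0 then 0 else d k * fps_nth F (n - 1))"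
    for k F n
    by (simp add: b_def mult.assoc)
  have rec: "G (Suc k) = a k * G k + b k * G (Suc (Suc k))" for k
  proof (rule fps_ext)
    fix n
    show "fps_nth (G (Suc k)) n = fps_nth (a k * G k + b k * G (Suc (Suc k))) n"
      by (cases k; cases n)
        (simp_all add: G_def H_def a_def b_mult_nth dyck_weight_eq_0 del: fps_mult_nth_0)
  qed
  have "has_cfrac (G 1) (\<lambda>k. a (Suc k) * b k)"
    by (rule has_cfrac_three_term[of b G a, OF _ rec]) (simp_all add: G_def a_def b_def)
  then show ?thesis
    by (simp add: G_def H_def a_def b_def mult.assoc flip: fps_const_mult)
qed

section \<open>Pattern statistics and concatenation\<close>

fun adj_count :: "('b \<Rightarrow> 'b \<Rightarrow> bool) \<Rightarrow> 'b list \<Rightarrow> nat" where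
  "adj_count P (a # b # w) = of_bool (P a b) + adj_count P (b # w)"
| "adj_count P w = 0"

lemma adj_count_Cons:
  "adj_count P (a # w) = of_bool (w \<noteq> [] \<and> P a (hd w)) + adj_count P w"
  by (cases w) auto

lemma adj_count_append:
  "adj_count P (xs @ ys) =
     adj_count P xs + of_bool (xs \<noteq> [] \<and> ys \<noteq> [] \<and> P (last xs) (hd ys)) + adj_count P ys"
  by (induction xs) (auto simp: adj_count_Cons)

lemma adj_count_eq_0:
  "(\<And>a b. a \<in> set w \<Longrightarrow> b \<in> set w \<Longrightarrow> \<not> P a b) \<Longrightarrow> adj_count P w = 0"
  by (induction P w rule: adj_count.induct) auto

lemma adj_count_conv_card: "adj_count P w = card {i. Suc i < length w \<and> P (w ! i) (w ! Suc i)}"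
proof (induction P w rule: adj_count.induct)
  case (1 P a b w)
  let ?S = "{i. Suc i < length (b # w) \<and> P ((b # w) ! i) ((b # w) ! Suc i)}"
  have "{i. Suc i < length (a # b # w) \<and> P ((a # b # w) ! i) ((a # b # w) ! Suc i)}
      = (if P a b then {0} else {}) \<union> Suc ` ?S"
    by (auto simp: nth_Cons' image_iff less_Suc_eq_0_disj split: if_splits)
  moreover have "finite ?S"
    by (rule finite_subset[of _ "{..length w}"]) auto
  ultimately show ?case
    using 1 by (auto simp: card_image card_insert_if)
qed auto

lemma pat_12_conv_adj_count: "pat_12 w = adj_count (<) w"
  by (simp add: pat_12_def adj_count_conv_card)

lemma pat_21_conv_adj_count: "pat_21 w = adj_count (>) w"
  by (simp add: pat_21_def adj_count_conv_card)

definition descents_across :: "nat \<Rightarrow> nat list \<Rightarrow> nat" where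
  "descents_across v = adj_count (\<lambda>a b. b < v \<and> v < a)"

lemma descents_across_Nil [simp]: "descents_across v [] = 0"
  by (simp add: descents_across_def)

lemma descents_across_conv_card:
  "descents_across v w = card {i. Suc i < length w \<and> w ! Suc i < v \<and> v < w ! i}"
  by (simp add: descents_across_def adj_count_conv_card)

lemma pat_2_31_Nil [simp]: "pat_2_31 [] = 0"
  by (simp add: pat_2_31_def)

lemma pat_2_31_Cons: "pat_2_31 (v # w) = descents_across v w + pat_2_31 w"
proof -
  let ?P = "\<lambda>w i j. i < j \<and> Suc j < length w \<and> w ! Suc j < w ! i \<and> w ! i < w ! j"
  let ?A = "{j. Suc j < length w \<and> w ! Suc j < v \<and> v < w ! j}"
  let ?B = "{(i, j). ?P w i j}"
  have "(i, j) \<in> (\<lambda>j. (0, Suc j)) ` ?A \<union> (\<lambda>(i, j). (Suc i, Suc j)) ` ?B"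
    if "?P (v # w) i j" for i j
  proof (cases i)
    case 0
    with that show ?thesis by (cases j) auto
  next
    case (Suc i')
    with that show ?thesis by (cases j) force+
  qed
  then have eq: "{(i, j). ?P (v # w) i j}
      = (\<lambda>j. (0, Suc j)) ` ?A \<union> (\<lambda>(i, j). (Suc i, Suc j)) ` ?B"
    by auto
  have "finite ?A"
    by (rule finite_subset[of _ "{..length w}"]) auto
  moreover have "finite ?B"
    by (rule finite_subset[of _ "{..length w} \<times> {..length w}"]) auto
  ultimately have "pat_2_31 (v # w)
      = card ((\<lambda>j. (0::nat, Suc j)) ` ?A) + card ((\<lambda>(i, j). (Suc i, Suc j)) ` ?B)"
    unfolding pat_2_31_def eq by (intro card_Un_disjoint) auto
  also have "card ((\<lambda>j. (0::nat, Suc j)) ` ?A) = descents_across v w"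
    unfolding descents_across_conv_card by (intro card_image) (auto simp: inj_on_def)
  also have "card ((\<lambda>(i, j). (Suc i, Suc j)) ` ?B) = pat_2_31 w"
    unfolding pat_2_31_def by (intro card_image) (auto simp: inj_on_def)
  finally show ?thesis .
qed

lemma pat_31_2_Nil [simp]: "pat_31_2 [] = 0"
  by (simp add: pat_31_2_def)

lemma pat_31_2_snoc: "pat_31_2 (w @ [v]) = descents_across v w + pat_31_2 w"
proof -
  let ?P = "\<lambda>w i j. Suc i < j \<and> j < length w \<and> w ! Suc i < w ! j \<and> w ! j < w ! i"
  let ?A = "{i. Suc i < length w \<and> w ! Suc i < v \<and> v < w ! i}"
  let ?B = "{(i, j). ?P w i j}"
  have eq: "{(i, j). ?P (w @ [v]) i j} = (\<lambda>i. (i, length w)) ` ?A \<union> ?B"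
    by (auto simp: nth_append image_iff less_Suc_eq)
  have "finite ?A"
    by (rule finite_subset[of _ "{..length w}"]) auto
  moreover have "finite ?B"
    by (rule finite_subset[of _ "{..length w} \<times> {..length w}"]) auto
  ultimately have "pat_31_2 (w @ [v]) = card ((\<lambda>i. (i, length w)) ` ?A) + pat_31_2 w"
    unfolding pat_31_2_def eq by (intro card_Un_disjoint) auto
  also have "card ((\<lambda>i. (i, length w)) ` ?A) = descents_across v w"
    unfolding descents_across_conv_card by (intro card_image) (auto simp: inj_on_def)
  finally show ?thesis .
qed

lemma descents_across_eq_0:
  "\<forall>a\<in>set w. a \<le> v \<Longrightarrow> descents_across v w = 0"
  unfolding descents_across_def by (rule adj_count_eq_0) force

lemma descents_across_Cons:
  "descents_across v (a # w) = of_bool (w \<noteq> [] \<and> hd w < v \<and> v < a) + descents_across v w"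
  by (simp add: descents_across_def adj_count_Cons)

lemma descents_across_append_Cons:
  "v \<le> b \<Longrightarrow> descents_across v (X @ b # Y) = descents_across v X + descents_across v (b # Y)"
  by (simp add: descents_across_def adj_count_append)

lemma descents_across_above_append:
  assumes "S \<noteq> []" "\<forall>a\<in>set S. v < a"
  shows "descents_across v (S @ Y) = of_bool (Y \<noteq> [] \<and> hd Y < v) + descents_across v Y"
  using assms
proof (induction S rule: list_nonempty_induct)
  case (single a)
  then show ?case by (simp add: descents_across_Cons)
next
  case (cons a S)
  then have "\<not> hd S < v" by (cases S) auto
  with cons show ?case by (simp add: descents_across_Cons)
qed

lemma descents_across_replace_above:
  assumes "S \<noteq> []" "\<forall>a\<in>set S. v < a" "S' \<noteq> []" "\<forall>a\<in>set S'. v < a"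
  shows "descents_across v (X @ S @ Y) = descents_across v (X @ S' @ Y)"
proof -
  have split: "descents_across v (X @ S @ Y)
      = descents_across v X + (of_bool (Y \<noteq> [] \<and> hd Y < v) + descents_across v Y)"
    if above: "S \<noteq> []" "\<forall>a\<in>set S. v < a" for S
  proof -
    obtain a R where "S = a # R" using above(1) by (cases S) auto
    then have "descents_across v (X @ S @ Y) = descents_across v X + descents_across v (S @ Y)"
      using above(2) by (simp add: descents_across_append_Cons)
    then show ?thesis using descents_across_above_append[OF above] by simp
  qed
  show ?thesis using split[of S] split[of S'] assms by simp
qed

lemma pat_2_31_replicate_append:
  assumes "\<forall>a\<in>set w. a \<le> T"
  shows "pat_2_31 (replicate k T @ w) = pat_2_31 w"
  using assms by (induction k) (simp_all add: pat_2_31_Cons descents_across_eq_0 ball_Un)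

lemma pat_31_2_append_replicate:
  assumes "\<forall>a\<in>set w. a \<le> T"
  shows "pat_31_2 (w @ replicate k T) = pat_31_2 w"
proof (induction k)
  case (Suc k)
  have "pat_31_2 (w @ replicate (Suc k) T) = pat_31_2 ((w @ replicate k T) @ [T])"
    by (simp add: replicate_append_same)
  also have "\<dots> = pat_31_2 (w @ replicate k T)"
    using assms by (simp only: pat_31_2_snoc) (simp add: descents_across_eq_0 ball_Un)
  finally show ?case using Suc by simp
qed simp

lemma pat_12_snoc_max:
  assumes "\<forall>a\<in>set w. a < T" "w \<noteq> []"
  shows "pat_12 (w @ [T]) = 1 + pat_12 w"
  using assms by (simp add: pat_12_conv_adj_count adj_count_append)

lemma pat_21_snoc_max:
  assumes "\<forall>a\<in>set w. a < T"
  shows "pat_21 (w @ [T]) = pat_21 w"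
proof -
  have "last w < T" if "w \<noteq> []"
    using assms last_in_set[OF that] by blast
  then show ?thesis
    by (auto simp: pat_21_conv_adj_count adj_count_append)
qed

lemma pat_2_31_snoc_max:
  assumes "\<forall>a\<in>set w. a < T"
  shows "pat_2_31 (w @ [T]) = pat_2_31 w"
  using assms
proof (induction w)
  case Nil
  then show ?case by (simp add: pat_2_31_Cons descents_across_eq_0)
next
  case (Cons v w)
  then have "descents_across v (w @ [T]) = descents_across v w"
    by (simp add: descents_across_append_Cons descents_across_Cons)
  with Cons show ?case by (simp add: pat_2_31_Cons)
qed

lemma pat_31_2_snoc_max:
  assumes "\<forall>a\<in>set w. a < T"
  shows "pat_31_2 (w @ [T]) = pat_31_2 w"
  using assms by (simp add: pat_31_2_snoc descents_across_eq_0 less_imp_le)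

section \<open>Isolated letters\<close>

definition isolated :: "'b \<Rightarrow> 'b list \<Rightarrow> bool" where
  "isolated t = successively (\<lambda>a b. a \<noteq> t \<or> b \<noteq> t)"

lemma isolated_append_Cons: "isolated t (A @ a # B) \<longleftrightarrow> isolated t (A @ [a]) \<and> isolated t (a # B)"
  by (auto simp: isolated_def successively_append_iff successively_Cons)

lemma isolated_append_Cons_neq:
  "a \<noteq> t \<Longrightarrow> isolated t (A @ a # B) \<longleftrightarrow> isolated t A \<and> isolated t B"
  by (auto simp: isolated_def successively_append_iff successively_Cons)

lemma isolated_append_replicate:
  "isolated t (A @ [t]) \<Longrightarrow> l \<le> 1 \<Longrightarrow> isolated t (A @ replicate l t)"
  by (cases l) (auto simp: isolated_def successively_append_iff)

lemma isolated_replicate_append: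
  "isolated t (t # B) \<Longrightarrow> r \<le> 1 \<Longrightarrow> isolated t (replicate r t @ B)"
  by (cases r) (auto simp: isolated_def successively_Cons)

lemma isolated_obtain_append_replicate:
  assumes "isolated t X"
  obtains A l where "X = A @ replicate l t" "l \<le> 1" "isolated t (A @ [t])"
proof (cases "X \<noteq> [] \<and> last X = t")
  case True
  then have "X = butlast X @ [t]" by (metis append_butlast_last_id)
  then show thesis
    using that[of "butlast X" 1] assms by simp
next
  case False
  then show thesis
    using that[of X 0] assms by (auto simp: isolated_def successively_append_iff)
qed

lemma isolated_obtain_replicate_append:
  assumes "isolated t Y"
  obtains B r where "Y = replicate r t @ B" "r \<le> 1" "isolated t (t # B)"
proof (cases "Y \<noteq> [] \<and> hd Y = t")
  case True
  then show thesis
    using that[of 1 "tl Y"] assms by (cases Y) simp_all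
next
  case False
  then show thesis
    using that[of 0 Y] assms by (auto simp: isolated_def successively_Cons)
qed

lemma append_replicate_eq_iff:
  assumes "isolated t (A @ [t])" "isolated t (A' @ [t])" "l \<le> 1" "l' \<le> 1"
  shows "A @ replicate l t = A' @ replicate l' t \<longleftrightarrow> A = A' \<and> l = l'"
  using assms by (cases l; cases l') (auto simp: isolated_def successively_append_iff)

lemma replicate_append_eq_iff:
  assumes "isolated t (t # B)" "isolated t (t # B')" "r \<le> 1" "r' \<le> 1"
  shows "replicate r t @ B = replicate r' t @ B' \<longleftrightarrow> r = r' \<and> B = B'"
  using assms by (cases r; cases r') (auto simp: isolated_def successively_Cons)

lemma isolated_snoc_notin: "t \<notin> set w \<Longrightarrow> isolated t (w @ [t])"
  by (induction w) (auto simp: isolated_def successively_Cons)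

lemma descents_across_isolated:
  assumes "isolated T w" "\<forall>a\<in>set w. a < u \<or> a = T" "u < T"
  shows "descents_across u w + of_bool (w \<noteq> [] \<and> last w = T) = count_list w T"
  using assms unfolding isolated_def descents_across_def
  by (induction "\<lambda>a b. b < u \<and> u < a" w rule: adj_count.induct) auto

lemma descents_across_append_replicate:
  assumes "isolated T (A @ [T])" "\<forall>a\<in>set A. a < u \<or> a = T" "u < T" "l \<le> 1"
  shows "descents_across u (A @ replicate l T) = count_list A T"
proof -
  have "descents_across u (A @ replicate l T)
      + of_bool (A @ replicate l T \<noteq> [] \<and> last (A @ replicate l T) = T)
      = count_list (A @ replicate l T) T"
    using assms by (intro descents_across_isolated isolated_append_replicate) auto
  moreover have "A \<noteq> [] \<longrightarrow> last A \<noteq> T"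
    using assms(1) by (auto simp: isolated_def successively_append_iff)
  ultimately show ?thesis
    using assms(4) by (cases l) auto
qed

lemma descents_across_replicate_append:
  assumes "isolated T (T # B)" "\<forall>a\<in>set B. a < u \<or> a = T" "u < T" "r \<le> 1"
    and "replicate r T @ B \<noteq> []" "last (T # B) = T"
  shows "descents_across u (replicate r T @ B) + 1 = r + count_list B T"
proof -
  have "last (replicate r T @ B) = T"
    using assms(5,6) by (cases r) (auto split: if_splits)
  moreover have "descents_across u (replicate r T @ B)
      + of_bool (replicate r T @ B \<noteq> [] \<and> last (replicate r T @ B) = T)
      = count_list (replicate r T @ B) T"
    using assms by (intro descents_across_isolated isolated_replicate_append) auto
  moreover have "count_list (replicate r T @ B) T = r + count_list B T"
    using assms(4) by (cases r) auto
  ultimately show ?thesis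
    using assms(5) by (simp only: simp_thms of_bool_eq)
qed

section \<open>Filling a hole\<close>

text \<open>The letter \<open>T\<close> plays the role of \<open>\<infinity>\<close>; a hole is an occurrence of \<open>T\<close> to be replaced.\<close>

definition fill :: "nat \<Rightarrow> nat \<Rightarrow> nat \<Rightarrow> nat \<Rightarrow> nat list \<Rightarrow> nat list \<Rightarrow> nat list" where
  "fill T u l r A B = A @ replicate l T @ u # replicate r T @ B"

lemma descents_across_fill:
  assumes "u < T" "\<forall>a\<in>set A \<union> set B. a < u \<or> a = T" "v < u \<or> v = T"
  shows "descents_across v (fill T u l r A B) = descents_across v (A @ T # B)"
  using assms(3)
proof
  assume "v < u"
  then have "descents_across v (A @ (replicate l T @ u # replicate r T) @ B)
      = descents_across v (A @ [T] @ B)"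
    using assms(1) by (intro descents_across_replace_above) auto
  then show ?thesis by (simp add: fill_def)
next
  assume "v = T"
  moreover have "a \<le> T" if "a \<in> set A \<union> set B" for a
    using assms(1) bspec[OF assms(2) that] by auto
  ultimately show ?thesis
    using assms(1) by (simp add: descents_across_eq_0 fill_def ball_Un)
qed

lemma pat_2_31_fill:
  assumes "u < T" "\<forall>a\<in>set A \<union> set B. a < u \<or> a = T"
  shows "pat_2_31 (fill T u l r A B)
    = pat_2_31 (A @ T # B) + descents_across u (replicate r T @ B)"
  using assms(2)
proof (induction A)
  case Nil
  then have "\<forall>a\<in>set B. a \<le> T" using assms(1) by force
  then show ?case
    using assms(1)
    by (simp add: fill_def pat_2_31_Cons pat_2_31_replicate_append descents_across_eq_0 ball_Un)
next
  case (Cons v A)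
  then have "descents_across v (fill T u l r A B) = descents_across v (A @ T # B)"
    using assms(1) by (intro descents_across_fill) auto
  with Cons show ?case by (simp add: fill_def pat_2_31_Cons)
qed

lemma pat_31_2_fill:
  assumes "u < T" "\<forall>a\<in>set A \<union> set B. a < u \<or> a = T"
  shows "pat_31_2 (fill T u l r A B)
    = pat_31_2 (A @ T # B) + descents_across u (A @ replicate l T)"
  using assms(2)
proof (induction B rule: rev_induct)
  case Nil
  then have le: "\<forall>a\<in>set A. a \<le> T" using assms(1) by force
  have "pat_31_2 (fill T u l r A []) = pat_31_2 ((A @ replicate l T) @ [u])"
    using le assms(1) pat_31_2_append_replicate[of "(A @ replicate l T) @ [u]" T r]
    by (simp add: fill_def ball_Un)
  also have "\<dots> = descents_across u (A @ replicate l T) + pat_31_2 A"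
    using le by (simp only: pat_31_2_snoc pat_31_2_append_replicate)
  also have "pat_31_2 A = pat_31_2 (A @ [T])"
    using le pat_31_2_append_replicate[of A T 1] by simp
  finally show ?case by simp
next
  case (snoc v B)
  have "descents_across v (fill T u l r A B) = descents_across v (A @ T # B)"
    using assms(1) snoc.prems by (intro descents_across_fill) auto
  with snoc show ?case
    using pat_31_2_snoc[of "fill T u l r A B" v] pat_31_2_snoc[of "A @ T # B" v]
    by (simp add: fill_def)
qed

lemma isolated_neighbours_less:
  assumes "\<forall>a\<in>set A \<union> set B. a < u \<or> a = T" "isolated T (A @ [T])" "isolated T (T # B)"
  shows "A \<noteq> [] \<Longrightarrow> last A < u" "B \<noteq> [] \<Longrightarrow> hd B < u"
  using assms last_in_set[of A] hd_in_set[of B]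
  by (auto simp: isolated_def successively_append_iff successively_Cons)

lemma pat_12_fill:
  assumes "u < T" "\<forall>a\<in>set A \<union> set B. a < u \<or> a = T"
    and "isolated T (A @ [T])" "isolated T (T # B)" "l \<le> 1" "r \<le> 1"
  shows "pat_12 (fill T u l r A B) = pat_12 (A @ T # B) + r"
  using assms(1,5,6) isolated_neighbours_less[OF assms(2-4)]
  by (cases l; cases r)
    (auto simp: fill_def pat_12_conv_adj_count adj_count_append adj_count_Cons)

lemma pat_21_fill:
  assumes "u < T" "\<forall>a\<in>set A \<union> set B. a < u \<or> a = T"
    and "isolated T (A @ [T])" "isolated T (T # B)" "l \<le> 1" "r \<le> 1"
  shows "pat_21 (fill T u l r A B) = pat_21 (A @ T # B) + l"
  using assms(1,5,6) isolated_neighbours_less[OF assms(2-4)]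
  by (cases l; cases r)
    (auto simp: fill_def pat_21_conv_adj_count adj_count_append adj_count_Cons)

section \<open>Partial permutations\<close>

definition partial_perms :: "nat \<Rightarrow> nat \<Rightarrow> nat \<Rightarrow> nat list set" where
  "partial_perms T v h =
     {w \<in> permutations_of_multiset (mset_set {1..v} + replicate_mset (Suc h) T).
        last w = T \<and> isolated T w}"

lemma finite_partial_perms: "finite (partial_perms T v h)"
  by (simp add: partial_perms_def)

lemma partial_perms_append_Cons_iff:
  "A @ T # B \<in> partial_perms T v h \<longleftrightarrow>
     mset A + mset B = mset_set {1..v} + replicate_mset h T \<and>
     isolated T (A @ [T]) \<and> isolated T (T # B) \<and> last (T # B) = T"
  by (auto simp: partial_perms_def permutations_of_multiset_def isolated_append_Cons[of T A T B])

lemma fill_in_partial_perms_iff: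
  assumes "Suc v < T" "h + l + r = Suc h'"
  shows "fill T (Suc v) l r A B \<in> partial_perms T (Suc v) h' \<longleftrightarrow>
     mset A + mset B = mset_set {1..v} + replicate_mset h T \<and>
     isolated T (A @ replicate l T) \<and> isolated T (replicate r T @ B) \<and>
     last (Suc v # replicate r T @ B) = T"
proof -
  have "mset (fill T (Suc v) l r A B)
      = add_mset (Suc v) (mset A + mset B + replicate_mset (l + r) T)"
    by (simp add: fill_def multiset_eq_iff)
  moreover have "mset_set {1..Suc v} + replicate_mset (Suc h') T
      = add_mset (Suc v) (mset_set {1..v} + replicate_mset h T + replicate_mset (l + r) T)"
    unfolding assms(2)[symmetric] by (simp add: atLeastAtMostSuc_conv) (simp add: multiset_eq_iff)
  moreover have "isolated T (fill T (Suc v) l r A B) \<longleftrightarrow>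
      isolated T (A @ replicate l T) \<and> isolated T (replicate r T @ B)"
    using assms(1) isolated_append_Cons_neq[of "Suc v" T "A @ replicate l T" "replicate r T @ B"]
    by (simp add: fill_def)
  moreover have "last (fill T (Suc v) l r A B) = last (Suc v # replicate r T @ B)"
    unfolding fill_def append_assoc[symmetric] by (rule last_appendR) simp
  ultimately show ?thesis
    by (simp only: partial_perms_def permutations_of_multiset_def mem_Collect_eq
        add_mset_add_mset_same_iff add_right_cancel) auto
qed

lemma partial_perms_append_ConsD:
  assumes "A @ T # B \<in> partial_perms T v h" "v < T"
  shows "\<forall>a\<in>set A \<union> set B. a < Suc v \<or> a = T"
    and "count_list A T + count_list B T = h"
proof -
  have mset: "mset A + mset B = mset_set {1..v} + replicate_mset h T"
    using assms(1) by (simp add: partial_perms_append_Cons_iff)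
  have "set A \<union> set B = set_mset (mset A + mset B)"
    by simp
  also have "\<dots> \<subseteq> {1..v} \<union> {T}"
    unfolding mset by auto
  finally show "\<forall>a\<in>set A \<union> set B. a < Suc v \<or> a = T"
    by auto
  show "count_list A T + count_list B T = h"
    using arg_cong[OF mset, of "\<lambda>M. count M T"] assms(2) by (simp add: count_mset)
qed

lemma partial_perms_0: "partial_perms T 0 h = (if h = 0 then {[T]} else {})"
proof -
  have "h = 0 \<and> w = [T]" if "w \<in> partial_perms T 0 h" for w
  proof -
    have mset: "mset w = replicate_mset (Suc h) T"
      using that by (simp add: partial_perms_def permutations_of_multiset_def)
    have "set w = {T}" "length w = Suc h"
      using arg_cong[OF mset, of set_mset] arg_cong[OF mset, of size] by simp_all
    then have "w = replicate (Suc h) T"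
      by (intro replicate_eqI) auto
    then show ?thesis
      using that by (cases h) (auto simp: partial_perms_def isolated_def)
  qed
  then have "partial_perms T 0 h \<subseteq> (if h = 0 then {[T]} else {})" by auto
  moreover have "(if h = 0 then {[T]} else {}) \<subseteq> partial_perms T 0 h"
    by (simp add: partial_perms_def permutations_of_multiset_def isolated_def)
  ultimately show ?thesis by (rule equalityI)
qed

lemma partial_perms_eq_image_snoc:
  assumes "v < T"
  shows "partial_perms T v 0 = (\<lambda>\<pi>. \<pi> @ [T]) ` permutations_of_set {1..v}"
proof -
  have snoc_iff: "\<pi> @ [T] \<in> partial_perms T v 0 \<longleftrightarrow> \<pi> \<in> permutations_of_set {1..v}" for \<pi>
  proof -
    have "isolated T (\<pi> @ [T])" if "mset \<pi> = mset_set {1..v}"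
    proof (rule isolated_snoc_notin)
      show "T \<notin> set \<pi>"
        using arg_cong[OF that, of set_mset] assms by simp
    qed
    then show ?thesis
      by (auto simp: partial_perms_def permutations_of_set_altdef permutations_of_multiset_def)
  qed
  have "w \<in> (\<lambda>\<pi>. \<pi> @ [T]) ` permutations_of_set {1..v}" if "w \<in> partial_perms T v 0" for w
  proof -
    have "w \<noteq> []" "last w = T"
      using that by (auto simp: partial_perms_def permutations_of_multiset_def)
    then have "w = butlast w @ [T]" by (metis append_butlast_last_id)
    then show ?thesis using that snoc_iff by (metis image_eqI)
  qed
  then show ?thesis using snoc_iff by auto
qed

text \<open>The last letter \<open>T\<close> has \<open>h\<close> letters \<open>T\<close> before it and is a hole only for \<open>r > 0\<close>.\<close>

definition holes :: "nat \<Rightarrow> nat \<Rightarrow> nat \<Rightarrow> nat \<Rightarrow> (nat list \<times> nat list) set" where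
  "holes T v h r = {(A, B). A @ T # B \<in> partial_perms T v h \<and> count_list A T < h + r}"

lemma in_holes_iff:
  assumes "A @ T # B \<in> partial_perms T v h" "v < T"
  shows "(A, B) \<in> holes T v h r \<longleftrightarrow> replicate r T @ B \<noteq> []"
proof -
  have "count_list B T = 0 \<longleftrightarrow> B = []"
    using assms(1) last_in_set[of B]
    by (auto simp: partial_perms_append_Cons_iff count_list_0_iff split: if_splits)
  then show ?thesis
    using assms(1) partial_perms_append_ConsD(2)[OF assms] by (auto simp: holes_def)
qed

lemma fill_in_partial_perms:
  assumes "Suc v < T" "(A, B) \<in> holes T v h r" "l \<le> 1" "r \<le> 1" "h + l + r = Suc h'"
  shows "fill T (Suc v) l r A B \<in> partial_perms T (Suc v) h'"
proof -
  have mem: "A @ T # B \<in> partial_perms T v h"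
    using assms(2) by (simp add: holes_def)
  then have "last (Suc v # replicate r T @ B) = T"
    using assms(1,2) in_holes_iff[OF mem, of r]
    by (cases r) (auto simp: partial_perms_append_Cons_iff split: if_splits)
  with mem show ?thesis
    using assms
    by (simp add: fill_in_partial_perms_iff[OF assms(1,5)] partial_perms_append_Cons_iff
        isolated_append_replicate isolated_replicate_append)
qed

lemma partial_perms_Suc_obtain_fill:
  assumes T: "Suc v < T" and w: "w \<in> partial_perms T (Suc v) h'"
  obtains h l r A B where "w = fill T (Suc v) l r A B" "(A, B) \<in> holes T v h r"
    "l \<le> 1" "r \<le> 1" "h + l + r = Suc h'"
proof -
  have mset: "mset w = mset_set {1..Suc v} + replicate_mset (Suc h') T"
    and last: "last w = T" and isolated: "isolated T w"
    using w by (auto simp: partial_perms_def permutations_of_multiset_def)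
  have "Suc v \<in># mset w" unfolding mset by simp
  then obtain X Y where XY: "w = X @ Suc v # Y" by (metis in_multiset_in_set split_list)
  then have "isolated T X" "isolated T Y"
    using isolated T by (simp_all add: isolated_append_Cons_neq)
  then obtain A l B r where X: "X = A @ replicate l T" and l: "l \<le> 1" "isolated T (A @ [T])"
    and Y: "Y = replicate r T @ B" and r: "r \<le> 1" "isolated T (T # B)"
    by (metis isolated_obtain_append_replicate isolated_obtain_replicate_append)
  have fill: "w = fill T (Suc v) l r A B"
    by (simp add: XY X Y fill_def)
  have "Suc h' = count (mset w) T"
    unfolding mset using T by simp
  also have "\<dots> = count_list A T + count_list B T + l + r"
    using T unfolding fill by (simp add: fill_def flip: count_mset)
  finally have h: "(count_list A T + count_list B T) + l + r = Suc h'" by simp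
  note mem = w[unfolded fill fill_in_partial_perms_iff[OF T h]]
  then have "A @ T # B \<in> partial_perms T v (count_list A T + count_list B T)"
    using l r T by (auto simp: partial_perms_append_Cons_iff split: if_splits)
  moreover from this have "(A, B) \<in> holes T v (count_list A T + count_list B T) r"
    using T mem by (subst in_holes_iff) auto
  ultimately show thesis
    using that fill l(1) r(1) h by blast
qed

lemma fill_inject:
  assumes T: "Suc v < T"
    and mem: "A @ T # B \<in> partial_perms T v h" "A' @ T # B' \<in> partial_perms T v k"
    and le: "l \<le> 1" "r \<le> 1" "l' \<le> 1" "r' \<le> 1"
    and eq: "fill T (Suc v) l r A B = fill T (Suc v) l' r' A' B'"
  shows "l = l' \<and> r = r' \<and> A = A' \<and> B = B'"
proof -
  have notin: "Suc v \<notin> set (A @ replicate l T)" "Suc v \<notin> set (replicate r T @ B)"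
    using partial_perms_append_ConsD(1)[OF mem(1)] T by auto
  have "A @ replicate l T = A' @ replicate l' T \<and> replicate r T @ B = replicate r' T @ B'"
    unfolding append_Cons_eq_iff[OF notin, symmetric] using eq by (simp add: fill_def)
  then show ?thesis
    using mem le
    by (simp add: partial_perms_append_Cons_iff append_replicate_eq_iff replicate_append_eq_iff)
qed

section \<open>The weighted enumeration\<close>

lemma ex_split_count_list:
  assumes "j < count_list w t"
  shows "\<exists>A B. w = A @ t # B \<and> count_list A t = j"
  using assms
proof (induction w arbitrary: j)
  case (Cons a w)
  show ?case
  proof (cases "a = t \<and> j = 0")
    case True
    then show ?thesis by (intro exI[of _ "[]"] exI[of _ w]) simp
  next
    case False
    then have "j - of_bool (a = t) < count_list w t"
      using Cons.prems by (auto split: if_splits)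
    then obtain A B where "w = A @ t # B" "count_list A t = j - of_bool (a = t)"
      using Cons.IH by blast
    then show ?thesis
      using False by (intro exI[of _ "a # A"] exI[of _ B]) auto
  qed
qed simp

lemma split_count_list_unique:
  assumes "A @ t # B = A' @ t # B'" "count_list A t = count_list A' t"
  shows "A = A' \<and> B = B'"
  using assms
proof (induction A arbitrary: A')
  case Nil
  then show ?case by (cases A') auto
next
  case (Cons a A)
  then show ?case by (cases A') (auto split: if_splits)
qed

lemma bij_betw_holes:
  assumes "v < T" "r \<le> 1"
  shows "bij_betw (\<lambda>(A, B). (A @ T # B, count_list A T)) (holes T v h r)
    (partial_perms T v h \<times> {..<h + r})"
proof (rule bij_betw_imageI)
  show "inj_on (\<lambda>(A, B). (A @ T # B, count_list A T)) (holes T v h r)"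
    by (auto simp: inj_on_def dest: split_count_list_unique)
  show "(\<lambda>(A, B). (A @ T # B, count_list A T)) ` holes T v h r = partial_perms T v h \<times> {..<h + r}"
  proof (intro equalityI subsetI)
    fix z assume "z \<in> partial_perms T v h \<times> {..<h + r}"
    then obtain w j where z: "z = (w, j)" and w: "w \<in> partial_perms T v h" and j: "j < h + r"
      by blast
    have "count (mset w) T = Suc h"
      using w assms(1) by (simp add: partial_perms_def permutations_of_multiset_def)
    then have "j < count_list w T"
      using j assms(2) by (simp add: count_mset)
    then obtain A B where "w = A @ T # B" "count_list A T = j"
      using ex_split_count_list by metis
    then show "z \<in> (\<lambda>(A, B). (A @ T # B, count_list A T)) ` holes T v h r"
      using w j by (force simp: z holes_def)
  qed (auto simp: holes_def)
qed

definition weight :: "'a::comm_ring_1 \<Rightarrow> 'a \<Rightarrow> 'a \<Rightarrow> 'a \<Rightarrow> nat list \<Rightarrow> 'a" where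
  "weight x y p q w = x ^ pat_12 w * y ^ pat_21 w * p ^ pat_2_31 w * q ^ pat_31_2 w"

definition total_weight :: "'a::comm_ring_1 \<Rightarrow> 'a \<Rightarrow> 'a \<Rightarrow> 'a \<Rightarrow> nat \<Rightarrow> nat \<Rightarrow> nat \<Rightarrow> 'a" where
  "total_weight x y p q T v h = (\<Sum>w\<in>partial_perms T v h. weight x y p q w)"

lemma weight_fill:
  fixes x y p q :: "'a::comm_ring_1"
  assumes T: "Suc v < T" and hole: "(A, B) \<in> holes T v h r" and le: "l \<le> 1" "r \<le> 1"
  shows "weight x y p q (fill T (Suc v) l r A B) =
    x ^ r * y ^ l * (p ^ (h + r - 1 - count_list A T) * q ^ count_list A T) *
    weight x y p q (A @ T # B)"
proof -
  have mem: "A @ T # B \<in> partial_perms T v h" and "v < T"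
    using hole T by (simp_all add: holes_def)
  then have isolated: "isolated T (A @ [T])" "isolated T (T # B)" and last: "last (T # B) = T"
    by (simp_all add: partial_perms_append_Cons_iff)
  note letters = partial_perms_append_ConsD(1)[OF mem \<open>v < T\<close>]
  have left: "descents_across (Suc v) (A @ replicate l T) = count_list A T"
    using isolated(1) letters T le(1) by (intro descents_across_append_replicate) auto
  have "descents_across (Suc v) (replicate r T @ B) + 1 = r + count_list B T"
    using isolated(2) letters T le(2) last hole in_holes_iff[OF mem \<open>v < T\<close>]
    by (intro descents_across_replicate_append) auto
  then have right: "descents_across (Suc v) (replicate r T @ B) = h + r - 1 - count_list A T"
    using partial_perms_append_ConsD(2)[OF mem \<open>v < T\<close>] by linarith
  show ?thesis
    unfolding weight_def pat_12_fill[OF T letters isolated le]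
      pat_21_fill[OF T letters isolated le] pat_2_31_fill[OF T letters]
      pat_31_2_fill[OF T letters] left right
    by (simp add: power_add mult_ac)
qed

lemma pq_bracket_rev: "pq_bracket p q n = (\<Sum>j<n. p ^ (n - 1 - j) * q ^ j)"
  unfolding pq_bracket_def by (subst sum.nat_diff_reindex[symmetric]) (auto intro!: sum.cong)

lemma sum_weight_fill:
  fixes x y p q :: "'a::comm_ring_1"
  assumes T: "Suc v < T" and le: "l \<le> 1" "r \<le> 1"
  shows "(\<Sum>(A, B)\<in>holes T v h r. weight x y p q (fill T (Suc v) l r A B)) =
    x ^ r * y ^ l * pq_bracket p q (h + r) * total_weight x y p q T v h"
proof -
  let ?g = "\<lambda>w j. x ^ r * y ^ l * (p ^ (h + r - 1 - j) * q ^ j) * weight x y p q w"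
  have "(\<Sum>(A, B)\<in>holes T v h r. weight x y p q (fill T (Suc v) l r A B))
      = (\<Sum>(A, B)\<in>holes T v h r. ?g (A @ T # B) (count_list A T))"
    by (rule sum.cong) (auto simp: weight_fill[OF T _ le])
  also have "\<dots> = (\<Sum>(w, j)\<in>partial_perms T v h \<times> {..<h + r}. ?g w j)"
    using T le(2)
    by (subst sum.reindex_bij_betw[OF bij_betw_holes, symmetric]) (simp_all add: case_prod_unfold)
  also have "\<dots> = (\<Sum>w\<in>partial_perms T v h. \<Sum>j<h + r. ?g w j)"
    by (rule sum.cartesian_product[symmetric])
  also have "\<dots> = x ^ r * y ^ l * pq_bracket p q (h + r) * total_weight x y p q T v h"
    by (simp only: pq_bracket_rev total_weight_def sum_distrib_left sum_distrib_right)
  finally show ?thesis .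
qed

text \<open>The ways to obtain a word with \<open>h' + 1\<close> letters \<open>T\<close>, from a word with \<open>h + 1\<close> of them.\<close>

definition fill_types :: "nat \<Rightarrow> (nat \<times> nat \<times> nat) set" where
  "fill_types h' = {(h, l, r). l \<le> 1 \<and> r \<le> 1 \<and> h + l + r = Suc h'}"

lemma fill_types_eq:
  "fill_types h = {(Suc h, 0, 0), (h, 0, 1), (h, 1, 0)} \<union> (if h = 0 then {} else {(h - 1, 1, 1)})"
  by (auto simp: fill_types_def le_Suc_eq)

lemma bij_betw_fill:
  assumes T: "Suc v < T"
  shows "bij_betw (\<lambda>((h, l, r), (A, B)). fill T (Suc v) l r A B)
    (SIGMA (h, l, r) : fill_types h'. holes T v h r) (partial_perms T (Suc v) h')"
    (is "bij_betw ?f ?S _")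
proof (rule bij_betw_imageI)
  show "inj_on ?f ?S"
  proof (clarsimp simp: inj_on_def)
    fix h l r A B k l' r' A' B'
    assume "(h, l, r) \<in> fill_types h'" "(A, B) \<in> holes T v h r"
      and "(k, l', r') \<in> fill_types h'" "(A', B') \<in> holes T v k r'"
      and eq: "fill T (Suc v) l r A B = fill T (Suc v) l' r' A' B'"
    then show "h = k \<and> l = l' \<and> r = r' \<and> A = A' \<and> B = B'"
      using fill_inject[OF T _ _ _ _ _ _ eq, of h k] by (auto simp: fill_types_def holes_def)
  qed
  show "?f ` ?S = partial_perms T (Suc v) h'"
  proof (intro equalityI subsetI)
    fix w assume "w \<in> ?f ` ?S"
    then show "w \<in> partial_perms T (Suc v) h'"
      using fill_in_partial_perms[OF T] by (auto simp: fill_types_def)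
  next
    fix w assume "w \<in> partial_perms T (Suc v) h'"
    then obtain h l r A B where w: "w = fill T (Suc v) l r A B" and "(A, B) \<in> holes T v h r"
      "l \<le> 1" "r \<le> 1" "h + l + r = Suc h'"
      by (rule partial_perms_Suc_obtain_fill[OF T])
    then have "((h, l, r), (A, B)) \<in> ?S"
      by (simp add: fill_types_def)
    then show "w \<in> ?f ` ?S"
      unfolding w by (rule rev_image_eqI) simp
  qed
qed

lemma finite_holes:
  assumes "v < T" "r \<le> 1"
  shows "finite (holes T v h r)"
  using bij_betw_finite[OF bij_betw_holes[OF assms]] by (simp add: finite_partial_perms)

lemma total_weight_Suc:
  fixes x y p q :: "'a::comm_ring_1"
  assumes T: "Suc v < T"
  shows "total_weight x y p q T (Suc v) h' =
    (\<Sum>(h, l, r)\<in>fill_types h'.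
       x ^ r * y ^ l * pq_bracket p q (h + r) * total_weight x y p q T v h)"
proof -
  have "total_weight x y p q T (Suc v) h'
      = (\<Sum>((h, l, r), (A, B))\<in>(SIGMA (h, l, r) : fill_types h'. holes T v h r).
           weight x y p q (fill T (Suc v) l r A B))"
    unfolding total_weight_def
    by (subst sum.reindex_bij_betw[OF bij_betw_fill[OF T], symmetric])
      (simp add: case_prod_unfold)
  also have "\<dots> = (\<Sum>(h, l, r)\<in>fill_types h'. \<Sum>(A, B)\<in>holes T v h r.
       weight x y p q (fill T (Suc v) l r A B))"
    using T unfolding case_prod_unfold
    by (subst sum.Sigma) (auto simp: fill_types_eq finite_holes case_prod_unfold)
  also have "\<dots> = (\<Sum>(h, l, r)\<in>fill_types h'.
       x ^ r * y ^ l * pq_bracket p q (h + r) * total_weight x y p q T v h)"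
    by (rule sum.cong) (auto simp: fill_types_def sum_weight_fill[OF T])
  finally show ?thesis .
qed

definition up_weight :: "'a::comm_ring_1 \<Rightarrow> 'a \<Rightarrow> 'a \<Rightarrow> 'a \<Rightarrow> nat \<Rightarrow> 'a" where
  "up_weight x y p q k = (if even k then x else y * pq_bracket p q (k div 2 + 1))"

definition down_weight :: "'a::comm_ring_1 \<Rightarrow> 'a \<Rightarrow> nat \<Rightarrow> 'a" where
  "down_weight p q k = (if even k then pq_bracket p q (k div 2 + 1) else 1)"

text \<open>A fill is a pair of steps. The choice of \<open>r\<close> leads from level \<open>2 h\<close> to level \<open>2 (h + r) - 1\<close>,
  where \<open>h + r\<close> is the number of holes; the choice of \<open>l\<close> and of the hole leads on to level
  \<open>2 (h + l + r - 1)\<close>.\<close>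

lemma total_weight_eq_dyck_weight:
  fixes x y p q :: "'a::comm_ring_1"
  assumes "v < T"
  shows "total_weight x y p q T v h
    = dyck_weight (up_weight x y p q) (down_weight p q) (2 * v) (2 * h)"
  using assms
proof (induction v arbitrary: h)
  case 0
  have "weight x y p q [T] = 1"
    by (simp add: weight_def pat_12_conv_adj_count pat_21_conv_adj_count pat_2_31_Cons
        pat_31_2_snoc[of "[]", simplified])
  then show ?case by (simp add: total_weight_def partial_perms_0)
next
  case (Suc v)
  let ?W = "dyck_weight (up_weight x y p q) (down_weight p q)"
  have IH: "total_weight x y p q T v h = ?W (2 * v) (2 * h)" for h
    using Suc by simp
  have "total_weight x y p q T (Suc v) h
      = pq_bracket p q (Suc h) * (?W (2 * v) (2 * Suc h) + x * ?W (2 * v) (2 * h))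
      + y * pq_bracket p q h * (?W (2 * v) (2 * h) + x * ?W (2 * v) (2 * (h - 1)))"
  proof (cases h)
    case 0
    then show ?thesis
      by (simp add: total_weight_Suc[OF Suc.prems] fill_types_eq IH pq_bracket_def algebra_simps)
  next
    case (Suc g)
    then show ?thesis
      by (simp add: total_weight_Suc[OF Suc.prems] fill_types_eq IH algebra_simps)
  qed
  also have "\<dots> = ?W (2 * Suc v) (2 * h)"
    by (cases h)
      (simp_all add: up_weight_def down_weight_def pq_bracket_def[of p q 0] algebra_simps)
  finally show ?case .
qed

lemma weight_snoc_max:
  assumes "\<forall>a\<in>set \<pi>. a < T" "\<pi> \<noteq> []"
  shows "weight x y p q (\<pi> @ [T])
    = x ^ (1 + pat_12 \<pi>) * y ^ pat_21 \<pi> * p ^ pat_2_31 \<pi> * q ^ pat_31_2 \<pi>"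
  using assms
  by (simp add: weight_def pat_12_snoc_max pat_21_snoc_max pat_2_31_snoc_max pat_31_2_snoc_max)

lemma dyck_weight_eq_sum_permutations:
  fixes x y p q :: "'a::comm_ring_1"
  assumes "n > 0"
  shows "dyck_weight (up_weight x y p q) (down_weight p q) (2 * n) 0 =
    (\<Sum>\<pi> \<in> permutations_of_set {1..n} - {[]}.
       x ^ (1 + pat_12 \<pi>) * y ^ pat_21 \<pi> * p ^ pat_2_31 \<pi> * q ^ pat_31_2 \<pi>)"
proof -
  have "dyck_weight (up_weight x y p q) (down_weight p q) (2 * n) 0
      = total_weight x y p q (Suc n) n 0"
    by (simp add: total_weight_eq_dyck_weight)
  also have "\<dots> = (\<Sum>\<pi> \<in> permutations_of_set {1..n}. weight x y p q (\<pi> @ [Suc n]))"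
    unfolding total_weight_def partial_perms_eq_image_snoc[OF lessI]
    by (subst sum.reindex) (auto simp: inj_on_def)
  also have "permutations_of_set {1..n} = permutations_of_set {1..n} - {[]}"
    using assms by (auto simp: permutations_of_set_def)
  finally show ?thesis
    by (simp add: weight_snoc_max permutations_of_set_def)
qed

theorem theorem6:
  fixes x y p q :: "'a::comm_ring_1"
  shows "has_cfrac
    (1 + Abs_fps (\<lambda>n. \<Sum>\<pi> \<in> permutations_of_set {1..n} - {[]}.
       x ^ (1 + pat_12 \<pi>) * y ^ pat_21 \<pi> * p ^ pat_2_31 \<pi> * q ^ pat_31_2 \<pi>))
    (\<lambda>k. fps_const ((if even k then x else y) * pq_bracket p q (k div 2 + 1)) * fps_X)"
proof -
  let ?F = "1 + Abs_fps (\<lambda>n. \<Sum>\<pi> \<in> permutations_of_set {1..n} - {[]}.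
    x ^ (1 + pat_12 \<pi>) * y ^ pat_21 \<pi> * p ^ pat_2_31 \<pi> * q ^ pat_31_2 \<pi>)"
  let ?up = "up_weight x y p q" and ?down = "down_weight p q"
  have "Abs_fps (\<lambda>n. dyck_weight ?up ?down (2 * n) 0) = ?F"
  proof (rule fps_ext)
    fix n
    show "fps_nth (Abs_fps (\<lambda>n. dyck_weight ?up ?down (2 * n) 0)) n = fps_nth ?F n"
      using dyck_weight_eq_sum_permutations[of n x y p q] by (cases "n = 0") simp_all
  qed
  moreover have "?up k * ?down k = (if even k then x else y) * pq_bracket p q (k div 2 + 1)" for k
    by (simp add: up_weight_def down_weight_def)
  ultimately show ?thesis
    using has_cfrac_dyck_weight[of ?up ?down] by simp
qed

end
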